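(* Let $\mathcal A$ be a $\mathbb Z^n$-graded associative commutative algebra with unit and let $\alpha\in\mathbb Z^n$. For any supercanonical structure $S\in\mathcal D^\alpha(\mathcal A)$ (resp. $S\in\mathcal{DE}^\alpha(\mathcal A)$) the formula $$\{a,b\}_S=(-1)^{\langle a+\alpha,S+\alpha\rangle}S(a,b)$$ defines a graded Jacobi (resp. graded Poisson) bracket on $\mathcal A$ of degree $|S|$. Conversely, every graded Jacobi (resp. Poisson) bracket $\{\cdot,\cdot\}$ of degree $\alpha$ on $\mathcal A$ determines, by $S(a,b)=\{a,b\}$, a supercanonical structure $S$ of $\mathcal D^\alpha(\mathcal A)$ (resp. $\mathcal{DE}^\alpha(\mathcal A)$).
   Context: Fix a ground field of characteristic $0$; $\langle\cdot,\cdot\rangle$ is the standard pairing on $\mathbb Z^n$. $\mathcal A$ is graded commutative: $ab=(-1)^{\langle |a|,|b|\rangle}ba$, with unit $\mathbf 1$. All elements in formulas are homogeneous and in exponents a symbol denotes its degree. A graded Jacobi bracket of degree $k$ on $\mathcal A$ is a bilinear map $\{\cdot,\cdot\}$ with $|\{a,b\}|=|a|+|b|+k$ and: $\{a,b\}=-(-1)^{\langle a+k,b+k\rangle}\{b,a\}$; $\{a,bc\}=\{a,b\}c+(-1)^{\langle a+k,b\rangle}b\{a,c\}-\{a,\mathbf 1\}bc$; $\{\{a,b\},c\}=\{a,\{b,c\}\}-(-1)^{\langle a+k,b+k\rangle}\{b,\{a,c\}\}$. It is a graded Poisson bracket if moreover $\{a,\mathbf 1\}=0$ for all $a$. The graded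 $\mathcal A$-bimodules $\mathcal D^\alpha_i=\mathcal D^\alpha_i(\mathcal A)$ are defined by induction, with right module structure $p\cdot a=(-1)^{\langle a,p+i\alpha\rangle}a\cdot p$ for $p\in\mathcal D^\alpha_i$. $\mathcal D^\alpha_0=\mathcal A$. $\mathcal D^\alpha_1$ is the space of graded linear maps $D:\mathcal A\to\mathcal A$ ($|D(a)|=|D|+|a|$) with $D(ab)=D(a)b+(-1)^{\langle a,D\rangle}aD(b)-D(\mathbf 1)ab$. For $i>1$, $\mathcal D^\alpha_i$ consists of graded linear maps $D:\mathcal A\to\mathcal D^\alpha_{i-1}$ with $D(ab)=D(a)\cdot b+(-1)^{\langle a,D+(i-1)\alpha\rangle}a\cdot D(b)-D(\mathbf 1)\cdot ab$ and $D(a,b)=-(-1)^{\langle a+\alpha,b+\alpha\rangle}D(b,a)$, where $D(a_1,\dots,a_j)=D(a_1,\dots,a_{j-1})(a_j)$; left module structure $(a\cdot D)(b)=a\cdot D(b)$. $\mathcal D^\alpha(\mathcal A)=\bigoplus_i\mathcal D^\alpha_i$; $\mathcal{DE}^\alpha_i=\{D\in\mathcal D^\alpha_i:D(\mathbf 1)=0\}$, $\mathcal{DE}^\alpha(\mathcal A)=\bigoplus_i\mathcal{DE}^\alpha_i$. The graded Schouten-Jacobi bracket on $\mathcal D^\alpha(\mathcal A)$, mapping $\mathcal D^\alpha_i\times\mathcal D^\alpha_j$ to $\mathcal D^\alpha_{i+j-1}$, is defined inductively by $[\![a,b]\!]=0$ for $a,b\in\mathcal A$; $[\![D,a]\!]=D(a)$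 and $[\![a,D]\!]=(-1)^{\langle a-\alpha,D+(i-1)\alpha\rangle+i}D(a)$ for $a\in\mathcal A$, $D\in\mathcal D^\alpha_i$; and $[\![A,B]\!](a)=(-1)^{\langle a-\alpha,B+(j-1)\alpha\rangle+j-1}[\![A(a),B]\!]+[\![A,B(a)]\!]$ for $A\in\mathcal D^\alpha_i$, $B\in\mathcal D^\alpha_j$. A supercanonical structure is a homogeneous element $S\in\mathcal D^\alpha_2(\mathcal A)$ such that $\langle |S|+\alpha,|S|+\alpha\rangle$ is even and $[\![S,S]\!]=0$; it is in $\mathcal{DE}^\alpha(\mathcal A)$ if $S\in\mathcal{DE}^\alpha_2$. *)

theory Defs
  imports "HOL-Analysis.Analysis" "HOL-Library.Function_Algebras"
begin

text \<open>
  Degrees live in \<open>int ^ 'n\<close>, the group \<open>\<int>\<^sup>n\<close> with \<open>n = CARD('n)\<close>.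
\<close>

definition pairing :: "int ^ 'n \<Rightarrow> int ^ 'n \<Rightarrow> int"  ("\<langle>_, _\<rangle>")
  where "\<langle>p, q\<rangle> = (\<Sum>i\<in>UNIV. p $ i * q $ i)"

text \<open>\<open>signed e x\<close> is \<open>(-1)\<^sup>e x\<close>.\<close>

definition signed :: "int \<Rightarrow> 'b::uminus \<Rightarrow> 'b"
  where "signed e x = (if even e then x else - x)"

text \<open>
  \<open>A p\<close> is the homogeneous part of degree \<open>p\<close> of the algebra, whose underlying
  space is the whole type \<open>'a\<close>. The sort \<open>{ring, monoid_mult}\<close> says: associative ring with unit
  (and, unlike \<open>ring_1\<close>, admits the zero algebra).
\<close>

locale graded_comm_algebra = vector_space scl
  for scl :: "'k::field_char_0 \<Rightarrow> 'a::{ring, monoid_mult} \<Rightarrow> 'a" +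
  fixes A :: "int ^ 'n \<Rightarrow> 'a set"
  assumes scale_mult_left: "scl c (x * y) = scl c x * y"
    and scale_mult_right: "scl c (x * y) = x * scl c y"
    and subspace_A: "subspace (A p)"
    and direct_sum: "\<exists>!f. finite {p. f p \<noteq> 0} \<and> (\<forall>p. f p \<in> A p) \<and> x = (\<Sum>p | f p \<noteq> 0. f p)"
    and one_A: "1 \<in> A 0"
    and mult_A: "a \<in> A p \<Longrightarrow> b \<in> A q \<Longrightarrow> a * b \<in> A (p + q)"
    and graded_commute: "a \<in> A p \<Longrightarrow> b \<in> A q \<Longrightarrow> a * b = signed \<langle>p, q\<rangle> (b * a)"

text \<open>Homogeneous components, and the linear extension of an expression \<open>F p a\<close> which is
  given for homogeneous \<open>a\<close> of degree \<open>p\<close> only.\<close>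

definition hcomp :: "(int ^ 'n \<Rightarrow> 'a::comm_monoid_add set) \<Rightarrow> 'a \<Rightarrow> int ^ 'n \<Rightarrow> 'a"
  where "hcomp A x =
    (THE f. finite {p. f p \<noteq> 0} \<and> (\<forall>p. f p \<in> A p) \<and> x = (\<Sum>p | f p \<noteq> 0. f p))"

definition hom_extend ::
    "(int ^ 'n \<Rightarrow> 'a::comm_monoid_add set) \<Rightarrow> (int ^ 'n \<Rightarrow> 'a \<Rightarrow> 'b::comm_monoid_add) \<Rightarrow> 'a \<Rightarrow> 'b"
  where "hom_extend A F x = (\<Sum>p | hcomp A x p \<noteq> 0. F p (hcomp A x p))"

text \<open>
  An element \<open>D\<close> of \<open>\<D>\<^sub>i\<close> is encoded by the function sending the list \<open>[a\<^sub>1, \<dots>, a\<^sub>i]\<close> to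
  \<open>D(a\<^sub>1, \<dots>, a\<^sub>i) = D(a\<^sub>1)(a\<^sub>2)\<dots>(a\<^sub>i)\<close> and all lists of any other length to \<open>0\<close>.
  All the spaces \<open>\<D>\<^sub>i\<close> then sit in the one group \<open>'a list \<Rightarrow> 'a\<close> with its pointwise operations.
  An element \<open>a\<close> of \<open>\<D>\<^sub>0 = \<A>\<close> becomes \<open>const_op a\<close>, the element \<open>D(a)\<close> of \<open>\<D>\<^sub>i\<^sub>-\<^sub>1\<close> is
  \<open>ev D a\<close>, and a bilinear map becomes \<open>binary_op\<close> of it.
\<close>

definition const_op :: "'a::zero \<Rightarrow> 'a list \<Rightarrow> 'a"
  where "const_op a xs = (case xs of [] \<Rightarrow> a | _ \<Rightarrow> 0)"

definition binary_op :: "('a \<Rightarrow> 'a \<Rightarrow> 'a::zero) \<Rightarrow> 'a list \<Rightarrow> 'a"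
  where "binary_op br xs = (case xs of [a, b] \<Rightarrow> br a b | _ \<Rightarrow> 0)"

definition ev :: "('a list \<Rightarrow> 'a) \<Rightarrow> 'a \<Rightarrow> 'a list \<Rightarrow> 'a"
  where "ev D a = (\<lambda>xs. D (a # xs))"

definition lmul :: "'a::times \<Rightarrow> ('a list \<Rightarrow> 'a) \<Rightarrow> 'a list \<Rightarrow> 'a"
  where "lmul a D = (\<lambda>xs. a * D xs)"

text \<open>\<open>rmul \<alpha> i d D p a\<close> is \<open>D \<cdot> a\<close> for \<open>D \<in> \<D>\<^sub>i\<close> of degree \<open>d\<close> and \<open>a\<close> of degree \<open>p\<close>.\<close>

definition rmul :: "int ^ 'n \<Rightarrow> nat \<Rightarrow> int ^ 'n \<Rightarrow> ('a list \<Rightarrow> 'a) \<Rightarrow> int ^ 'n \<Rightarrow> 'a::{times, uminus} \<Rightarrow> 'a list \<Rightarrow> 'a"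
  where "rmul \<alpha> i d D p a = signed \<langle>p, d + int i *s \<alpha>\<rangle> (lmul a D)"

text \<open>\<open>D\<close>, viewed as a map on \<open>\<A>\<close>, is linear and of degree \<open>d\<close> into the graded space with
  homogeneous parts \<open>M\<close>.\<close>

definition graded_linear_op ::
    "('k::field \<Rightarrow> 'a::ab_group_add \<Rightarrow> 'a) \<Rightarrow> (int ^ 'n \<Rightarrow> 'a set) \<Rightarrow> (int ^ 'n \<Rightarrow> ('a list \<Rightarrow> 'a) set)
      \<Rightarrow> int ^ 'n \<Rightarrow> ('a list \<Rightarrow> 'a) \<Rightarrow> bool"
  where "graded_linear_op scl A M d D \<longleftrightarrow>
    D [] = 0 \<and>
    Vector_Spaces.linear scl (\<lambda>c E xs. scl c (E xs)) (ev D) \<and>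
    (\<forall>p. \<forall>a \<in> A p. ev D a \<in> M (d + p))"

text \<open>\<open>Dop scl A \<alpha> i d\<close> is the homogeneous part of degree \<open>d\<close> of \<open>\<D>\<^sub>i\<^sup>\<alpha>(\<A>)\<close>. In the last
  equation the order is \<open>i + 2\<close>, so that \<open>ev D a\<close> has order \<open>i + 1\<close>.\<close>

fun Dop :: "('k::field \<Rightarrow> 'a::{ring, monoid_mult} \<Rightarrow> 'a) \<Rightarrow> (int ^ 'n \<Rightarrow> 'a set) \<Rightarrow> int ^ 'n
    \<Rightarrow> nat \<Rightarrow> int ^ 'n \<Rightarrow> ('a list \<Rightarrow> 'a) set"
  where
    "Dop scl A \<alpha> 0 d = const_op ` A d"
  | "Dop scl A \<alpha> (Suc 0) d =
      {D. graded_linear_op scl A (Dop scl A \<alpha> 0) d D \<and>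
          (\<forall>p q. \<forall>a \<in> A p. \<forall>b \<in> A q.
             D [a * b] = D [a] * b + signed \<langle>p, d\<rangle> (a * D [b]) - D [1] * (a * b))}"
  | "Dop scl A \<alpha> (Suc (Suc i)) d =
      {D. graded_linear_op scl A (Dop scl A \<alpha> (Suc i)) d D \<and>
          (\<forall>p q. \<forall>a \<in> A p. \<forall>b \<in> A q.
             ev D (a * b) =
               rmul \<alpha> (Suc i) (d + p) (ev D a) q b
               + signed \<langle>p, d + int (Suc i) *s \<alpha>\<rangle> (lmul a (ev D b))
               - rmul \<alpha> (Suc i) d (ev D 1) (p + q) (a * b)) \<and>
          (\<forall>p q. \<forall>a \<in> A p. \<forall>b \<in> A q.
             ev (ev D a) b = - signed \<langle>p + \<alpha>, q + \<alpha>\<rangle> (ev (ev D b) a))}"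

definition DEop :: "('k::field \<Rightarrow> 'a::{ring, monoid_mult} \<Rightarrow> 'a) \<Rightarrow> (int ^ 'n \<Rightarrow> 'a set) \<Rightarrow> int ^ 'n
    \<Rightarrow> nat \<Rightarrow> int ^ 'n \<Rightarrow> ('a list \<Rightarrow> 'a) set"
  where "DEop scl A \<alpha> i d = {D \<in> Dop scl A \<alpha> i d. ev D 1 = 0}"

text \<open>
  \<open>SJ A \<alpha> i p F j q G\<close> is the Schouten-Jacobi bracket of \<open>F \<in> \<D>\<^sub>i\<close> of degree \<open>p\<close> and
  \<open>G \<in> \<D>\<^sub>j\<close> of degree \<open>q\<close>. An element \<open>F\<close> of \<open>\<D>\<^sub>0 = \<A>\<close> is recovered as \<open>F []\<close>.
\<close>

fun SJ :: "(int ^ 'n \<Rightarrow> 'a::ab_group_add set) \<Rightarrow> int ^ 'n \<Rightarrow> nat \<Rightarrow> int ^ 'n \<Rightarrow> ('a list \<Rightarrow> 'a)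
    \<Rightarrow> nat \<Rightarrow> int ^ 'n \<Rightarrow> ('a list \<Rightarrow> 'a) \<Rightarrow> 'a list \<Rightarrow> 'a"
  where
    "SJ A \<alpha> 0 p F 0 q G = 0"
  | "SJ A \<alpha> (Suc i) p F 0 q G = ev F (G [])"
  | "SJ A \<alpha> 0 p F (Suc j) q G =
      signed (\<langle>p - \<alpha>, q + int j *s \<alpha>\<rangle> + int (Suc j)) (ev G (F []))"
  | "SJ A \<alpha> (Suc i) p F (Suc j) q G =
      (\<lambda>xs. case xs of [] \<Rightarrow> 0 | x # ys \<Rightarrow>
        hom_extend A (\<lambda>d a.
          signed (\<langle>d - \<alpha>, q + int j *s \<alpha>\<rangle> + int j) (SJ A \<alpha> i (p + d) (ev F a) (Suc j) q G)
          + SJ A \<alpha> (Suc i) p F j (q + d) (ev G a)) x ys)"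

text \<open>\<open>s\<close> is the degree of \<open>S\<close>; it is an argument because the degree of \<open>S = 0\<close> is arbitrary.\<close>

definition supercanonical :: "('k::field \<Rightarrow> 'a::{ring, monoid_mult} \<Rightarrow> 'a) \<Rightarrow> (int ^ 'n \<Rightarrow> 'a set)
    \<Rightarrow> int ^ 'n \<Rightarrow> int ^ 'n \<Rightarrow> ('a list \<Rightarrow> 'a) \<Rightarrow> bool"
  where "supercanonical scl A \<alpha> s S \<longleftrightarrow>
    S \<in> Dop scl A \<alpha> 2 s \<and> even \<langle>s + \<alpha>, s + \<alpha>\<rangle> \<and> SJ A \<alpha> 2 s S 2 s S = 0"

definition supercanonical_DE :: "('k::field \<Rightarrow> 'a::{ring, monoid_mult} \<Rightarrow> 'a) \<Rightarrow> (int ^ 'n \<Rightarrow> 'a set)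
    \<Rightarrow> int ^ 'n \<Rightarrow> int ^ 'n \<Rightarrow> ('a list \<Rightarrow> 'a) \<Rightarrow> bool"
  where "supercanonical_DE scl A \<alpha> s S \<longleftrightarrow>
    supercanonical scl A \<alpha> s S \<and> S \<in> DEop scl A \<alpha> 2 s"

definition jacobi_bracket :: "('k::field \<Rightarrow> 'a::{ring, monoid_mult} \<Rightarrow> 'a) \<Rightarrow> (int ^ 'n \<Rightarrow> 'a set)
    \<Rightarrow> int ^ 'n \<Rightarrow> ('a \<Rightarrow> 'a \<Rightarrow> 'a) \<Rightarrow> bool"
  where "jacobi_bracket scl A k br \<longleftrightarrow>
    (\<forall>a. Vector_Spaces.linear scl scl (\<lambda>b. br a b)) \<and>
    (\<forall>b. Vector_Spaces.linear scl scl (\<lambda>a. br a b)) \<and>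
    (\<forall>p q. \<forall>a \<in> A p. \<forall>b \<in> A q. br a b \<in> A (p + q + k)) \<and>
    (\<forall>p q. \<forall>a \<in> A p. \<forall>b \<in> A q. br a b = - signed \<langle>p + k, q + k\<rangle> (br b a)) \<and>
    (\<forall>p q r. \<forall>a \<in> A p. \<forall>b \<in> A q. \<forall>c \<in> A r.
       br a (b * c) = br a b * c + signed \<langle>p + k, q\<rangle> (b * br a c) - br a 1 * b * c) \<and>
    (\<forall>p q r. \<forall>a \<in> A p. \<forall>b \<in> A q. \<forall>c \<in> A r.
       br (br a b) c = br a (br b c) - signed \<langle>p + k, q + k\<rangle> (br b (br a c)))"

definition poisson_bracket :: "('k::field \<Rightarrow> 'a::{ring, monoid_mult} \<Rightarrow> 'a) \<Rightarrow> (int ^ 'n \<Rightarrow> 'a set)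
    \<Rightarrow> int ^ 'n \<Rightarrow> ('a \<Rightarrow> 'a \<Rightarrow> 'a) \<Rightarrow> bool"
  where "poisson_bracket scl A k br \<longleftrightarrow> jacobi_bracket scl A k br \<and> (\<forall>a. br a 1 = 0)"

text \<open>\<open>derived_bracket A \<alpha> s S\<close> is \<open>{a, b}\<^sub>S\<close> for \<open>S\<close> of degree \<open>s\<close>.\<close>

definition derived_bracket :: "(int ^ 'n \<Rightarrow> 'a::ab_group_add set) \<Rightarrow> int ^ 'n \<Rightarrow> int ^ 'n
    \<Rightarrow> ('a list \<Rightarrow> 'a) \<Rightarrow> 'a \<Rightarrow> 'a \<Rightarrow> 'a"
  where "derived_bracket A \<alpha> s S a b = hom_extend A (\<lambda>p a. signed \<langle>p + \<alpha>, s + \<alpha>\<rangle> (S [a, b])) a"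

text \<open>On homogeneous arguments \<open>hom_extend\<close>, and hence the two notions built on it, are given by the
  formula that was extended.\<close>

context graded_comm_algebra
begin

lemma zero_A: "0 \<in> A p"
  using subspace_A by (rule subspace_0)

lemma hcomp_homogeneous:
  assumes "a \<in> A p"
  shows "hcomp A a = (\<lambda>q. if q = p then a else 0)"
proof -
  let ?f = "\<lambda>q. if q = p then a else 0"
  have supp: "{q. ?f q \<noteq> 0} = (if a = 0 then {} else {p})"
    by auto
  have "finite {q. ?f q \<noteq> 0} \<and> (\<forall>q. ?f q \<in> A q) \<and> a = (\<Sum>q | ?f q \<noteq> 0. ?f q)"
    unfolding supp using assms zero_A by auto
  then show ?thesis
    unfolding hcomp_def by (rule the1_equality[OF direct_sum])
qed

lemma hom_extend_homogeneous:
  assumes "a \<in> A p" and "F p 0 = 0"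
  shows "hom_extend A F a = F p a"
proof -
  have "{q. hcomp A a q \<noteq> 0} = (if a = 0 then {} else {p})"
    by (auto simp: hcomp_homogeneous[OF assms(1)])
  then show ?thesis
    unfolding hom_extend_def using assms(2) by (auto simp: hcomp_homogeneous[OF assms(1)])
qed

lemma hcomp_in_A: "hcomp A x p \<in> A p"
  using theI'[OF direct_sum, of x] unfolding hcomp_def by blast

lemma Dop_ev_zero:
  assumes "D \<in> Dop scl A \<alpha> (Suc i) d"
  shows "ev D 0 = 0"
proof -
  have "Vector_Spaces.linear scl (\<lambda>c E xs. scl c (E xs)) (ev D)"
    using assms by (cases i) (simp_all add: graded_linear_op_def)
  then show ?thesis
    unfolding Vector_Spaces.linear_def by (blast intro: module_hom.zero)
qed

lemma Dop_ev:
  assumes "D \<in> Dop scl A \<alpha> (Suc i) d" and "a \<in> A p"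
  shows "ev D a \<in> Dop scl A \<alpha> i (d + p)"
  using assms by (cases i) (simp_all add: graded_linear_op_def)

lemma SJ_zero:
  assumes "F \<in> Dop scl A \<alpha> i p" and "G \<in> Dop scl A \<alpha> j q" and "F = 0 \<or> G = 0"
  shows "SJ A \<alpha> i p F j q G = 0"
  using assms
proof (induction "i + j" arbitrary: i p F j q G rule: less_induct)
  case less
  have ev0: "ev 0 a = 0" for a :: 'a
    by (auto simp: ev_def)
  have sg0: "signed e (0 :: 'a list \<Rightarrow> 'a) = 0" for e
    by (simp add: signed_def)
  show ?case
  proof (cases i)
    case 0
    show ?thesis
    proof (cases j)
      case (Suc j')
      with less.prems have "ev G (F []) = 0"
        using Dop_ev_zero[of G \<alpha> j' q] ev0 by auto
      then show ?thesis
        by (simp add: 0 Suc sg0)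
    qed (simp add: 0)
  next
    case i: (Suc i')
    show ?thesis
    proof (cases j)
      case 0
      with i less.prems have "ev F (G []) = 0"
        using Dop_ev_zero[of F \<alpha> i' p] ev0 by auto
      then show ?thesis
        by (simp add: i 0)
    next
      case j: (Suc j')
      have "SJ A \<alpha> i' (p + d) (ev F a) j q G = 0" if "a \<in> A d" for a d
        using less.prems Dop_ev[of F \<alpha> i' p a d] that
        by (intro less.hyps) (auto simp: i ev0)
      moreover have "SJ A \<alpha> i p F j' (q + d) (ev G a) = 0" if "a \<in> A d" for a d
        using less.prems Dop_ev[of G \<alpha> j' q a d] that
        by (intro less.hyps) (auto simp: j ev0)
      ultimately show ?thesis
        by (auto simp: i j hom_extend_def hcomp_in_A sg0 split: list.splits)
    qed
  qed
qed

lemma SJ_homogeneous: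
  assumes F: "F \<in> Dop scl A \<alpha> (Suc i) p" and G: "G \<in> Dop scl A \<alpha> (Suc j) q" and a: "a \<in> A d"
  shows "ev (SJ A \<alpha> (Suc i) p F (Suc j) q G) a =
    signed (\<langle>d - \<alpha>, q + int j *s \<alpha>\<rangle> + int j) (SJ A \<alpha> i (p + d) (ev F a) (Suc j) q G)
    + SJ A \<alpha> (Suc i) p F j (q + d) (ev G a)"
proof -
  have "SJ A \<alpha> i (p + d) (ev F 0) (Suc j) q G = 0"
    using Dop_ev[OF F zero_A] G Dop_ev_zero[OF F] by (intro SJ_zero) auto
  moreover have "SJ A \<alpha> (Suc i) p F j (q + d) (ev G 0) = 0"
    using F Dop_ev[OF G zero_A] Dop_ev_zero[OF G] by (intro SJ_zero) auto
  ultimately show ?thesis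
    by (subst ev_def) (simp add: hom_extend_homogeneous[OF a] signed_def fun_eq_iff)
qed

lemma derived_bracket_homogeneous:
  assumes "S \<in> Dop scl A \<alpha> 2 s" and "a \<in> A p"
  shows "derived_bracket A \<alpha> s S a b = signed \<langle>p + \<alpha>, s + \<alpha>\<rangle> (S [a, b])"
proof -
  have "ev S 0 = 0"
    using assms(1) by (intro Dop_ev_zero) (simp only: numeral_2_eq_2)
  then have "S [0, b] = 0"
    by (auto simp: ev_def dest!: fun_cong[of _ _ "[b]"])
  then show ?thesis
    unfolding derived_bracket_def
    by (subst hom_extend_homogeneous[OF assms(2)]) (auto simp: signed_def)
qed

end

end

theory Submission
  imports Defs
begin

text \<open>
  For \<open>S \<in> \<D>\<^sub>2\<close> with \<open>\<langle>s + \<alpha>, s + \<alpha>\<rangle>\<close> even, unfolding the inductive definition gives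
  \<open>\<lbrakk>S, S\<rbrakk>(a, b, c) = 2 J(a, b, c)\<close>, where \<open>J\<close> is, up to a sign, the Jacobiator of \<open>{\<cdot>, \<cdot>}\<^sub>S\<close>.
  In characteristic \<open>0\<close> the vanishing of \<open>\<lbrakk>S, S\<rbrakk>\<close> is therefore the Jacobi identity. The symmetry
  of \<open>S\<close> is that of the bracket because \<open>\<langle>s + \<alpha>, s + \<alpha>\<rangle>\<close> is even, and the derivation rule of \<open>S\<close>
  in its first argument follows from the rule in the second argument and the symmetry.
\<close>

section \<open>Bilinearity of the pairing and the calculus of signs\<close>

lemma pairing_add_left: "\<langle>p + q, r\<rangle> = \<langle>p, r\<rangle> + \<langle>q, r\<rangle>"
  by (simp add: pairing_def distrib_right sum.distrib)

lemma pairing_commute: "\<langle>p, q\<rangle> = \<langle>q, p\<rangle>"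
  by (simp add: pairing_def mult.commute)

lemma pairing_add_right: "\<langle>p, q + r\<rangle> = \<langle>p, q\<rangle> + \<langle>p, r\<rangle>"
  by (metis pairing_add_left pairing_commute)

lemma pairing_minus_left: "\<langle>p - q, r\<rangle> = \<langle>p, r\<rangle> - \<langle>q, r\<rangle>"
  by (metis pairing_add_left add_diff_cancel_right' diff_add_cancel)

lemma pairing_minus_right: "\<langle>p, q - r\<rangle> = \<langle>p, q\<rangle> - \<langle>p, r\<rangle>"
  by (metis pairing_minus_left pairing_commute)

lemma pairing_scale_right: "\<langle>p, c *s q\<rangle> = c * \<langle>p, q\<rangle>"
  by (simp add: pairing_def sum_distrib_left mult.left_commute)

text \<open>The product \<open>2 * p\<close> is componentwise and equals \<open>p + p\<close>.
  Exponents with doubled degrees thus acquire an explicit factor 2, so that parities can be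
  compared.\<close>

lemma pairing_double: "\<langle>2 * p, q\<rangle> = 2 * \<langle>p, q\<rangle>" "\<langle>p, 2 * q\<rangle> = 2 * \<langle>p, q\<rangle>"
  by (simp_all only: mult_2 pairing_add_left pairing_add_right)

lemmas pairing_simps = pairing_add_left pairing_add_right pairing_minus_left pairing_minus_right
  pairing_scale_right pairing_double

lemma signed_apply: "signed e F x = signed e (F x)"
  by (simp add: signed_def)

lemma signed_zero [simp]: "signed e (0 :: 'a::group_add) = 0"
  by (simp add: signed_def)

lemma signed_add: "signed e (x + y) = signed e x + signed e (y :: 'a::ab_group_add)"
  by (simp add: signed_def)

lemma signed_sum: "signed e (\<Sum>i\<in>I. f i) = (\<Sum>i\<in>I. signed e (f i :: 'a::ab_group_add))"
  by (simp add: signed_def sum_negf)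

lemma signed_minus: "signed e (- x) = - signed e (x :: 'a::ab_group_add)"
  by (simp add: signed_def)

lemma signed_diff: "signed e (x - y) = signed e x - signed e (y :: 'a::ab_group_add)"
  by (simp add: signed_def)

lemma signed_signed: "signed e (signed f x) = signed (e + f) (x :: 'a::ab_group_add)"
  by (auto simp: signed_def)

lemma signed_mult_left: "signed e x * y = signed e (x * y :: 'a::ring)"
  by (simp add: signed_def)

lemma signed_mult_right: "x * signed e y = signed e (x * y :: 'a::ring)"
  by (simp add: signed_def)

lemma signed_cong: "even e = even f \<Longrightarrow> signed e x = signed f x"
  by (simp add: signed_def)

lemma signed_0 [simp]: "signed 0 x = x"
  by (simp add: signed_def)

lemma ev_add: "ev (F + G) a = ev F a + (ev G a :: 'a::plus list \<Rightarrow> 'a)"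
  by (simp add: ev_def fun_eq_iff)

lemma ev_signed: "ev (signed e F) a = signed e (ev F a)"
  by (simp add: ev_def signed_def fun_eq_iff)

section \<open>Linear maps on the algebra\<close>

context graded_comm_algebra
begin

text \<open>Characteristic 0 enters here, as the scalar 2 is nonzero in the ground field. This
  removes the factor 2 from \<lbrakk>S, S\<rbrakk>.\<close>

lemma double_eq_zero_iff: "x + x = 0 \<longleftrightarrow> x = 0" for x :: 'a
proof -
  have "x + x = scl 2 x"
    by (metis one_add_one scale_left_distrib scale_one)
  then show ?thesis
    by simp
qed

lemma linearI:
  assumes "\<And>x y. f (x + y) = f x + f y" and "\<And>c x. f (scl c x) = scl c (f x)"
  shows "Vector_Spaces.linear scl scl f"
  using assms by unfold_locales

lemma linear_zero: "Vector_Spaces.linear scl scl (\<lambda>x. 0)"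
  by (rule linearI) simp_all

lemma linear_mapD:
  assumes "Vector_Spaces.linear scl scl f"
  shows "f 0 = 0" and "f (x + y) = f x + f y" and "f (scl c x) = scl c (f x)"
    and "f (- x) = - f x" and "f (sum g I) = (\<Sum>i\<in>I. f (g i))"
proof -
  interpret f: Vector_Spaces.linear scl scl f
    by fact
  show "f 0 = 0" and "f (x + y) = f x + f y" and "f (scl c x) = scl c (f x)"
    and "f (- x) = - f x" and "f (sum g I) = (\<Sum>i\<in>I. f (g i))"
    by (rule f.zero f.add f.scale f.neg f.sum)+
qed

lemma linear_signed: "Vector_Spaces.linear scl scl f \<Longrightarrow> Vector_Spaces.linear scl scl (\<lambda>x. signed e (f x))"
  by (intro linearI) (simp_all add: signed_def linear_mapD scale_minus_right)

lemma vector_space_fun: "vector_space (\<lambda>c (E :: 'a list \<Rightarrow> 'a) xs. scl c (E xs))"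
  by unfold_locales (auto simp: fun_eq_iff scale_right_distrib scale_left_distrib)

text \<open>Maps of lists are added and scaled pointwise, so the remaining arguments
  \<open>xs\<close> can be fixed in advance.\<close>

lemma linear_ev_iff:
  "Vector_Spaces.linear scl (\<lambda>c E xs. scl c (E xs)) (ev D) \<longleftrightarrow>
    (\<forall>xs. Vector_Spaces.linear scl scl (\<lambda>x. D (x # xs)))"
  using vector_space_fun vector_space_axioms
  by (auto simp: Vector_Spaces.linear_def module_hom_iff module_iff_vector_space ev_def fun_eq_iff)

section \<open>Homogeneous components and linear extension\<close>

lemma hcomp_decomp: "finite {p. hcomp A x p \<noteq> 0}" "x = (\<Sum>p | hcomp A x p \<noteq> 0. hcomp A x p)"
  using theI'[OF direct_sum, of x] unfolding hcomp_def by blast+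

text \<open>Homogeneous decompositions are unique. The set \<open>P\<close> may exceed the support
  of \<open>f\<close>, which accommodates sums whose components cancel.\<close>

lemma hcomp_eqI:
  assumes "finite P" and "\<And>p. p \<notin> P \<Longrightarrow> f p = 0" and "\<And>p. f p \<in> A p" and "x = (\<Sum>p\<in>P. f p)"
  shows "hcomp A x = f"
proof -
  have "{p. f p \<noteq> 0} \<subseteq> P"
    using assms(2) by blast
  moreover from this have "x = (\<Sum>p | f p \<noteq> 0. f p)"
    unfolding assms(4) using assms(1) by (intro sum.mono_neutral_right) auto
  ultimately show ?thesis
    unfolding hcomp_def using assms(1,3)
    by (intro the1_equality[OF direct_sum]) (auto intro: finite_subset)
qed

lemma hcomp_sum_superset:
  assumes "finite P" and "{p. hcomp A x p \<noteq> 0} \<subseteq> P"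
  shows "(\<Sum>p\<in>P. hcomp A x p) = x"
  using assms by (subst (2) hcomp_decomp(2)) (intro sum.mono_neutral_right, auto)

lemma hcomp_add: "hcomp A (x + y) p = hcomp A x p + hcomp A y p"
proof -
  let ?P = "{p. hcomp A x p \<noteq> 0} \<union> {p. hcomp A y p \<noteq> 0}"
  have "hcomp A (x + y) = (\<lambda>p. hcomp A x p + hcomp A y p)"
    by (rule hcomp_eqI[where P = ?P])
      (auto simp: hcomp_decomp(1) sum.distrib hcomp_sum_superset subspace_add[OF subspace_A] hcomp_in_A)
  then show ?thesis
    by simp
qed

lemma hcomp_scale: "hcomp A (scl c x) p = scl c (hcomp A x p)"
proof -
  let ?P = "{p. hcomp A x p \<noteq> 0}"
  have "hcomp A (scl c x) = (\<lambda>p. scl c (hcomp A x p))"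
    by (rule hcomp_eqI[where P = ?P])
      (auto simp: hcomp_decomp(1) hcomp_sum_superset subspace_scale[OF subspace_A] hcomp_in_A
        simp flip: scale_sum_right)
  then show ?thesis
    by simp
qed

text \<open>The supports of \<open>x\<close>, \<open>y\<close> and \<open>x + y\<close> differ in
  general. Since \<open>F p 0 = 0\<close>, zero components may be included, and all three sums can
  run over one finite set.\<close>

lemma hom_extend_superset:
  assumes "finite P" and "{p. hcomp A x p \<noteq> 0} \<subseteq> P" and "\<And>p. F p 0 = 0"
  shows "hom_extend A F x = (\<Sum>p\<in>P. F p (hcomp A x p))"
  unfolding hom_extend_def using assms by (intro sum.mono_neutral_left) auto

lemma linear_hom_extend:
  assumes "\<And>p. Vector_Spaces.linear scl scl (F p)"
  shows "Vector_Spaces.linear scl scl (hom_extend A F)"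
proof (rule linearI)
  have F0: "F p 0 = 0" for p
    using assms by (rule linear_mapD)
  fix x y
  let ?P = "{p. hcomp A x p \<noteq> 0} \<union> {p. hcomp A y p \<noteq> 0}"
  have "hom_extend A F z = (\<Sum>p\<in>?P. F p (hcomp A z p))"
    if "z = x + y \<or> z = x \<or> z = y" for z
    using that by (intro hom_extend_superset) (auto simp: hcomp_decomp(1) F0 hcomp_add)
  then show "hom_extend A F (x + y) = hom_extend A F x + hom_extend A F y"
    by (simp add: hcomp_add sum.distrib linear_mapD(2)[OF assms])
next
  have F0: "F p 0 = 0" for p
    using assms by (rule linear_mapD)
  fix c x
  let ?P = "{p. hcomp A x p \<noteq> 0}"
  have "hom_extend A F z = (\<Sum>p\<in>?P. F p (hcomp A z p))"
    if "z = scl c x \<or> z = x" for z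
    using that by (intro hom_extend_superset) (auto simp: hcomp_decomp(1) F0 hcomp_scale)
  then show "hom_extend A F (scl c x) = scl c (hom_extend A F x)"
    by (simp add: hcomp_scale scale_sum_right linear_mapD(3)[OF assms])
qed

text \<open>Carries identities known for homogeneous arguments over to the whole algebra, by summing
  over the components of \<open>x\<close>.\<close>

lemma linear_eqI:
  assumes "Vector_Spaces.linear scl scl f" and "Vector_Spaces.linear scl scl g"
    and "\<And>p a. a \<in> A p \<Longrightarrow> f a = g a"
  shows "f x = g x"
  by (subst (1 2) hcomp_decomp(2)[of x])
    (simp add: linear_mapD(5)[OF assms(1)] linear_mapD(5)[OF assms(2)] assms(3)[OF hcomp_in_A])

section \<open>Operators determined by homogeneous first arguments\<close>

text \<open>An operator is extended from homogeneous first arguments. This property is stable under the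
  operations occurring in \<open>SJ\<close>, so that \<open>SJ = 0\<close> can be tested on homogeneous arguments only.\<close>

definition first_extended :: "('a list \<Rightarrow> 'a) \<Rightarrow> bool"
  where "first_extended T \<longleftrightarrow>
    T [] = 0 \<and> (\<forall>x xs. T (x # xs) = (\<Sum>p | hcomp A x p \<noteq> 0. T (hcomp A x p # xs)))"

lemma first_extendedI:
  assumes "T [] = 0" and "\<And>x xs. T (x # xs) = (\<Sum>p | hcomp A x p \<noteq> 0. T (hcomp A x p # xs))"
  shows "first_extended T"
  unfolding first_extended_def using assms by blast

lemma first_extendedD:
  assumes "first_extended T"
  shows "T [] = 0" and "T (x # xs) = (\<Sum>p | hcomp A x p \<noteq> 0. T (hcomp A x p # xs))"
  using assms unfolding first_extended_def by blast+

lemma first_extended_add: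
  assumes "first_extended T" and "first_extended U"
  shows "first_extended (T + U)"
proof (rule first_extendedI)
  fix x xs
  show "(T + U) (x # xs) = (\<Sum>p | hcomp A x p \<noteq> 0. (T + U) (hcomp A x p # xs))"
    unfolding plus_fun_apply sum.distrib
    by (rule arg_cong2[where f = "(+)"]) (rule first_extendedD(2), fact)+
qed (simp add: first_extendedD(1) assms)

lemma first_extended_signed:
  assumes "first_extended T"
  shows "first_extended (signed e T)"
proof (rule first_extendedI)
  fix x xs
  show "signed e T (x # xs) = (\<Sum>p | hcomp A x p \<noteq> 0. signed e T (hcomp A x p # xs))"
    unfolding signed_apply signed_sum[symmetric]
    by (rule arg_cong[where f = "signed e"]) (rule first_extendedD(2), fact)
qed (simp add: first_extendedD(1) assms signed_apply)

lemma first_extended_eq_zeroI: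
  assumes "first_extended T" and "\<And>p a. a \<in> A p \<Longrightarrow> ev T a = 0"
  shows "T = 0"
proof
  fix xs
  have "T (hcomp A x p # ys) = 0" for x p ys
    using assms(2)[OF hcomp_in_A[of x p]] by (simp add: ev_def fun_eq_iff)
  then have "T (x # ys) = 0" for x ys
    by (subst first_extendedD(2)[OF assms(1)]) simp
  then show "T xs = 0 xs"
    by (cases xs) (auto simp: first_extendedD(1)[OF assms(1)])
qed

lemma first_extended_linear:
  assumes "D [] = 0" and "Vector_Spaces.linear scl (\<lambda>c E xs. scl c (E xs)) (ev D)"
  shows "first_extended D"
proof (rule first_extendedI)
  fix x xs
  have "Vector_Spaces.linear scl scl (\<lambda>x. D (x # xs))"
    using assms(2) by (simp add: linear_ev_iff)
  from linear_mapD(5)[OF this, of "hcomp A x" "{p. hcomp A x p \<noteq> 0}"]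
  show "D (x # xs) = (\<Sum>p | hcomp A x p \<noteq> 0. D (hcomp A x p # xs))"
    unfolding hcomp_decomp(2)[symmetric] .
qed fact

lemma Dop_graded_linear_op:
  assumes "D \<in> Dop scl A \<alpha> (Suc i) d"
  shows "graded_linear_op scl A (Dop scl A \<alpha> i) d D"
  using assms by (cases i) simp_all

lemma first_extended_Dop:
  assumes "D \<in> Dop scl A \<alpha> (Suc i) d"
  shows "first_extended D"
  using Dop_graded_linear_op[OF assms] by (simp add: graded_linear_op_def first_extended_linear)

text \<open>For positive orders the bracket is by definition a \<open>hom_extend\<close> in its
  first argument, and \<open>SJ_homogeneous\<close> identifies each summand with the value of the
  bracket at that component.\<close>

lemma first_extended_SJ:
  assumes F: "F \<in> Dop scl A \<alpha> (Suc i) p" and G: "G \<in> Dop scl A \<alpha> (Suc j) q"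
  shows "first_extended (SJ A \<alpha> (Suc i) p F (Suc j) q G)"
proof (rule first_extendedI)
  fix x ys
  have sum_apply: "(\<Sum>p\<in>P. h p) xs = (\<Sum>p\<in>P. h p xs)"
    for P :: "(int ^ 'n) set" and h :: "_ \<Rightarrow> 'a list \<Rightarrow> 'a" and xs
    by (induction P rule: infinite_finite_induct) auto
  let ?F = "\<lambda>d a. signed (\<langle>d - \<alpha>, q + int j *s \<alpha>\<rangle> + int j) (SJ A \<alpha> i (p + d) (ev F a) (Suc j) q G)
          + SJ A \<alpha> (Suc i) p F j (q + d) (ev G a)"
  have "?F d (hcomp A x d) ys = SJ A \<alpha> (Suc i) p F (Suc j) q G (hcomp A x d # ys)" for d
    using SJ_homogeneous[OF F G hcomp_in_A, of x d] by (metis ev_def)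
  then have "(\<Sum>d | hcomp A x d \<noteq> 0. SJ A \<alpha> (Suc i) p F (Suc j) q G (hcomp A x d # ys)) = hom_extend A ?F x ys"
    unfolding hom_extend_def sum_apply by (intro sum.cong refl) (rule sym)
  then show "SJ A \<alpha> (Suc i) p F (Suc j) q G (x # ys) =
      (\<Sum>d | hcomp A x d \<noteq> 0. SJ A \<alpha> (Suc i) p F (Suc j) q G (hcomp A x d # ys))"
    by simp
qed simp

section \<open>The bracket of S with itself\<close>

text \<open>Up to sign the Jacobi expression of the derived bracket, for \<open>a\<close> and
  \<open>b\<close> of degrees \<open>p\<close> and \<open>q\<close>. It remains a function of lists,
  the form in which three evaluations of \<open>SJ\<close> produce it; the value at
  \<open>[]\<close> is the element of the algebra.\<close>

definition jacobiator :: "int ^ 'n \<Rightarrow> int ^ 'n \<Rightarrow> ('a list \<Rightarrow> 'a) \<Rightarrow> int ^ 'n \<Rightarrow> 'a \<Rightarrow> int ^ 'n \<Rightarrow> 'a \<Rightarrow> 'a \<Rightarrow> 'a list \<Rightarrow> 'a"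
  where "jacobiator \<alpha> s S p a q b c =
    ev (ev S (S [a, b])) c
    - signed \<langle>p + \<alpha>, s + \<alpha>\<rangle> (ev (ev S a) (S [b, c]))
    + signed \<langle>q + \<alpha>, s + p\<rangle> (ev (ev S b) (S [a, c]))"

text \<open>Unfolding the recursion on three homogeneous arguments produces six terms, which turn
  out to be two copies of each term of the \<open>jacobiator\<close>.\<close>

lemma SJ_self:
  assumes S: "S \<in> Dop scl A \<alpha> 2 s" and s: "even \<langle>s + \<alpha>, s + \<alpha>\<rangle>"
    and a: "a \<in> A p" and b: "b \<in> A q" and c: "c \<in> A r"
  shows "ev (ev (ev (SJ A \<alpha> 2 s S 2 s S) a) b) c = jacobiator \<alpha> s S p a q b c + jacobiator \<alpha> s S p a q b c"
proof -
  have S: "S \<in> Dop scl A \<alpha> (Suc (Suc 0)) s"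
    using S by (simp only: numeral_2_eq_2)
  note Sa = Dop_ev[OF S a] and Sb = Dop_ev[OF S b]
  have ev_eq: "ev (ev S x) y [] = S [x, y]" for x y
    by (simp add: ev_def)
  let ?X = "ev (ev S (S [a, b])) c" and ?Y = "ev (ev S a) (S [b, c])" and ?Z = "ev (ev S b) (S [a, c])"
  \<comment> \<open>The nesting of signs records the recursion. Each branch ends in a bracket with
    an element of order 0, for instance \<open>S [a, b]\<close> of degree
    \<open>s + p + q\<close>.\<close>
  have "ev (ev (ev (SJ A \<alpha> 2 s S 2 s S) a) b) c =
    signed (\<langle>p - \<alpha>, s + \<alpha>\<rangle> + 1) (signed (\<langle>q - \<alpha>, s + \<alpha>\<rangle> + 1) (signed (\<langle>s + p + q - \<alpha>, s + \<alpha>\<rangle> + 2) ?X)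
      + (signed \<langle>r - \<alpha>, s + q\<rangle> (signed (\<langle>s + p + r - \<alpha>, s + q\<rangle> + 1) ?Z) + ?Y))
    + (signed \<langle>q - \<alpha>, s + p\<rangle> (signed \<langle>r - \<alpha>, s + p\<rangle> (signed (\<langle>s + q + r - \<alpha>, s + p\<rangle> + 1) ?Y) + ?Z) + ?X)"
    unfolding numeral_2_eq_2
    by (simp add: SJ_homogeneous[OF S S a] SJ_homogeneous[OF Sa S b] SJ_homogeneous[OF S Sa b]
      SJ_homogeneous[OF Sa Sb c] SJ_homogeneous[OF Sb Sa c] ev_add ev_signed ev_eq
      del: SJ.simps(4))
  also have "\<dots> = signed (\<langle>p - \<alpha>, s + \<alpha>\<rangle> + \<langle>q - \<alpha>, s + \<alpha>\<rangle> + \<langle>s + p + q - \<alpha>, s + \<alpha>\<rangle>) ?X + ?X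
      - signed \<langle>p - \<alpha>, s + \<alpha>\<rangle> ?Y - signed (\<langle>q - \<alpha>, s + p\<rangle> + \<langle>r - \<alpha>, s + p\<rangle> + \<langle>s + q + r - \<alpha>, s + p\<rangle>) ?Y
      + signed (\<langle>p - \<alpha>, s + \<alpha>\<rangle> + \<langle>r - \<alpha>, s + q\<rangle> + \<langle>s + p + r - \<alpha>, s + q\<rangle>) ?Z + signed \<langle>q - \<alpha>, s + p\<rangle> ?Z"
    by (simp add: signed_def)
  \<comment> \<open>The two signs in front of each of \<open>?X\<close>, \<open>?Y\<close>,
    \<open>?Z\<close> differ modulo 2 by \<langle>s + \<alpha>, s + \<alpha>\<rangle>, which is
    even.\<close>
  also have "\<dots> = signed 0 ?X + ?X
      - signed \<langle>p + \<alpha>, s + \<alpha>\<rangle> ?Y - signed \<langle>p + \<alpha>, s + \<alpha>\<rangle> ?Y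
      + signed \<langle>q + \<alpha>, s + p\<rangle> ?Z + signed \<langle>q + \<alpha>, s + p\<rangle> ?Z"
    using s by (intro arg_cong2[where f = "(+)"] arg_cong2[where f = "(-)"] signed_cong refl)
      (auto simp: pairing_simps pairing_commute)
  finally show ?thesis
    by (simp add: jacobiator_def signed_0 algebra_simps)
qed

text \<open>One direction evaluates \<open>SJ_self\<close> at \<open>[]\<close> and cancels 2. In
  the other, homogeneity of the arguments is dropped one at a time, from the third back to the
  first.\<close>

lemma SJ_self_eq_zero_iff:
  assumes S: "S \<in> Dop scl A \<alpha> 2 s" and s: "even \<langle>s + \<alpha>, s + \<alpha>\<rangle>"
  shows "SJ A \<alpha> 2 s S 2 s S = 0 \<longleftrightarrow>
    (\<forall>p q r. \<forall>a \<in> A p. \<forall>b \<in> A q. \<forall>c \<in> A r. jacobiator \<alpha> s S p a q b c [] = 0)"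
    (is "?T = 0 \<longleftrightarrow> ?J")
proof
  assume "?T = 0"
  show ?J
  proof (intro allI ballI)
    fix p q r a b c
    assume "a \<in> A p" "b \<in> A q" "c \<in> A r"
    from SJ_self[OF S s this] \<open>?T = 0\<close> have "jacobiator \<alpha> s S p a q b c [] + jacobiator \<alpha> s S p a q b c [] = 0"
      by (simp add: ev_def fun_eq_iff)
    then show "jacobiator \<alpha> s S p a q b c [] = 0"
      by (simp only: double_eq_zero_iff)
  qed
next
  assume J: ?J
  have S2: "S \<in> Dop scl A \<alpha> (Suc (Suc 0)) s"
    using S by (simp only: numeral_2_eq_2)
  \<comment> \<open>Two evaluations lead to order 0, where \<open>const_op\<close> vanishes off the
    empty list.\<close>
  have S_nil: "S (x # y # z # zs) = 0" if "x \<in> A p" "y \<in> A q" for x y z zs p q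
    using Dop_ev[OF Dop_ev[OF S2 that(1)] that(2)] by (auto simp: ev_def const_op_def fun_eq_iff)
  have S_in: "S [x, y] \<in> A (s + p + q)" if "x \<in> A p" "y \<in> A q" for x y p q
    using Dop_ev[OF Dop_ev[OF S2 that(1)] that(2)] by (auto simp: ev_def const_op_def fun_eq_iff)
  have c0: "ev (ev (ev ?T a) b) c = 0" if "a \<in> A p" "b \<in> A q" "c \<in> A r" for a b c p q r
  proof
    fix xs
    show "ev (ev (ev ?T a) b) c xs = 0 xs"
    proof (cases xs)
      case Nil
      then show ?thesis
        using J that by (simp add: SJ_self[OF S s that])
    next
      case (Cons y ys)
      \<comment> \<open>With a fourth argument every term applies \<open>S\<close> to a list of at
        least three entries.\<close>
      have "S (S [a, b] # c # xs) = 0" "S (a # S [b, c] # xs) = 0" "S (b # S [a, c] # xs) = 0"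
        unfolding Cons by (rule S_nil S_in that)+
      then show ?thesis
        unfolding SJ_self[OF S s that] by (simp add: jacobiator_def ev_def signed_apply)
    qed
  qed
  have b0: "ev (ev ?T a) b = 0" if a: "a \<in> A p" and b: "b \<in> A q" for a b p q
  proof (rule first_extended_eq_zeroI[OF _ c0[OF a b]])
    note Sa = Dop_ev[OF S2 a] and Sb = Dop_ev[OF S2 b] and Sab = Dop_ev[OF S2 S_in[OF a b]]
    show "first_extended (ev (ev ?T a) b)"
      \<comment> \<open>After two evaluations the summands are, up to sign, brackets of two
        operators of order 1 and copies of \<open>ev S (S [a, b])\<close>, all of them
        \<open>first_extended\<close>.\<close>
      unfolding numeral_2_eq_2 SJ_homogeneous[OF S2 S2 a] ev_add ev_signed SJ_homogeneous[OF Sa S2 b]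
        SJ_homogeneous[OF S2 Sa b] SJ.simps(2,3)
      by (intro first_extended_add first_extended_signed first_extended_SJ[OF Sa Sb] first_extended_SJ[OF Sb Sa])
        (use first_extended_Dop[OF Sab] in \<open>simp_all add: ev_def\<close>)
  qed
  have a0: "ev ?T a = 0" if a: "a \<in> A p" for a p
  proof (rule first_extended_eq_zeroI[OF _ b0[OF a]])
    note Sa = Dop_ev[OF S2 a]
    show "first_extended (ev ?T a)"
      unfolding numeral_2_eq_2 SJ_homogeneous[OF S2 S2 a]
      by (intro first_extended_add first_extended_signed first_extended_SJ[OF Sa S2] first_extended_SJ[OF S2 Sa])
  qed
  show "?T = 0"
    by (rule first_extended_eq_zeroI[OF _ a0]) (use first_extended_SJ[OF S2 S2] in \<open>simp only: numeral_2_eq_2\<close>)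
qed

section \<open>From supercanonical structures to brackets\<close>

text \<open>The axioms of order 2 in terms of values on pairs. Linearity in the second argument is
  stated for homogeneous \<open>a\<close>, since only then does \<open>Dop\<close> place
  \<open>ev S a\<close> in a homogeneous part of order 1.\<close>

lemma Dop_2D:
  assumes S: "S \<in> Dop scl A \<alpha> 2 s"
  shows "Vector_Spaces.linear scl scl (\<lambda>a. S [a, b])"
    and "a \<in> A p \<Longrightarrow> Vector_Spaces.linear scl scl (\<lambda>b. S [a, b])"
    and "a \<in> A p \<Longrightarrow> b \<in> A q \<Longrightarrow> S [a, b] \<in> A (p + q + s)"
    and "a \<in> A p \<Longrightarrow> b \<in> A q \<Longrightarrow> S [a, b] = - signed \<langle>p + \<alpha>, q + \<alpha>\<rangle> (S [b, a])"
    and "a \<in> A p \<Longrightarrow> b \<in> A q \<Longrightarrow> c \<in> A r \<Longrightarrow>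
      S [a, b * c] = S [a, b] * c + signed \<langle>q, s + p\<rangle> (b * S [a, c]) - S [a, 1] * (b * c)"
proof -
  have S: "S \<in> Dop scl A \<alpha> (Suc (Suc 0)) s"
    using S by (simp only: numeral_2_eq_2)
  show "Vector_Spaces.linear scl scl (\<lambda>a. S [a, b])"
    using Dop_graded_linear_op[OF S] by (simp add: graded_linear_op_def linear_ev_iff)
  show "S [a, b] = - signed \<langle>p + \<alpha>, q + \<alpha>\<rangle> (S [b, a])" if "a \<in> A p" "b \<in> A q"
  proof -
    have "ev (ev S a) b = - signed \<langle>p + \<alpha>, q + \<alpha>\<rangle> (ev (ev S b) a)"
      using S that unfolding Dop.simps(3) by blast
    from fun_cong[OF this, of "[]"] show ?thesis
      by (simp add: ev_def signed_apply)
  qed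
  assume a: "a \<in> A p"
  note Sa = Dop_ev[OF S a]
  show "Vector_Spaces.linear scl scl (\<lambda>b. S [a, b])"
    using Dop_graded_linear_op[OF Sa] unfolding graded_linear_op_def linear_ev_iff by (simp add: ev_def)
  show "b \<in> A q \<Longrightarrow> c \<in> A r \<Longrightarrow>
      S [a, b * c] = S [a, b] * c + signed \<langle>q, s + p\<rangle> (b * S [a, c]) - S [a, 1] * (b * c)"
    using Sa unfolding Dop.simps(2) ev_def by blast
  assume b: "b \<in> A q"
  show "S [a, b] \<in> A (p + q + s)"
    using Dop_ev[OF Sa b] by (auto simp: ev_def const_op_def fun_eq_iff ac_simps)
qed

lemma signed_in_A: "x \<in> A p \<Longrightarrow> signed e x \<in> A p"
  by (simp add: signed_def subspace_neg[OF subspace_A])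

lemma linear_signed_arg:
  "Vector_Spaces.linear scl scl f \<Longrightarrow> f (signed e x) = signed e (f x)"
  by (simp add: signed_def linear_mapD)

lemma jacobi_bracket_derived:
  assumes "supercanonical scl A \<alpha> s S"
  shows "jacobi_bracket scl A s (derived_bracket A \<alpha> s S)"
proof -
  have S: "S \<in> Dop scl A \<alpha> 2 s" and s: "even \<langle>s + \<alpha>, s + \<alpha>\<rangle>" and SS: "SJ A \<alpha> 2 s S 2 s S = 0"
    using assms by (auto simp: supercanonical_def simp del: Dop.simps)
  let ?br = "derived_bracket A \<alpha> s S"
  note br = derived_bracket_homogeneous[OF S]
  note lin1 = Dop_2D(1)[OF S] and lin2 = Dop_2D(2)[OF S]
  have br_in: "?br a b \<in> A (p + q + s)" if "a \<in> A p" "b \<in> A q" for a b p q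
    unfolding br[OF that(1)] by (intro signed_in_A Dop_2D(3)[OF S] that)
  show ?thesis
    unfolding jacobi_bracket_def
  proof (intro conjI allI ballI)
    show "Vector_Spaces.linear scl scl (\<lambda>b. ?br a b)" for a
      \<comment> \<open>In \<open>b\<close> the bracket is a finite sum of maps that are linear
        because the components of \<open>a\<close> are homogeneous.\<close>
      unfolding derived_bracket_def hom_extend_def
      using linear_mapD(2,3)[OF linear_signed[OF lin2[OF hcomp_in_A[of a]]]]
      by (intro linearI) (simp_all add: sum.distrib scale_sum_right)
    show "Vector_Spaces.linear scl scl (\<lambda>a. ?br a b)" for b
      unfolding derived_bracket_def by (intro linear_hom_extend linear_signed lin1)
  next
    fix p q a b
    assume a: "a \<in> A p" and b: "b \<in> A q"
    show "?br a b \<in> A (p + q + s)"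
      by (rule br_in[OF a b])
    show "?br a b = - signed \<langle>p + s, q + s\<rangle> (?br b a)"
      unfolding br[OF a] br[OF b] Dop_2D(4)[OF S a b] signed_minus signed_signed
      \<comment> \<open>The sign in the derived bracket turns the symmetry governed by \<alpha> into
        the one governed by \<open>s\<close>: the two exponents differ modulo 2 by \<langle>s +
        \<alpha>, s + \<alpha>\<rangle>.\<close>
      using s by (intro arg_cong[where f = uminus] signed_cong) (auto simp: pairing_simps pairing_commute)
  next
    fix p q r a b c
    assume a: "a \<in> A p" and b: "b \<in> A q" and c: "c \<in> A r"
    show "?br a (b * c) = ?br a b * c + signed \<langle>p + s, q\<rangle> (b * ?br a c) - ?br a 1 * b * c"
      unfolding br[OF a] Dop_2D(5)[OF S a b c] signed_add signed_diff signed_mult_left signed_mult_right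
        signed_signed mult.assoc
      using s by (intro arg_cong2[where f = "(+)"] arg_cong2[where f = "(-)"] signed_cong refl)
        (auto simp: pairing_simps pairing_commute)
    let ?X = "S [S [a, b], c]" and ?Y = "S [a, S [b, c]]" and ?Z = "S [b, S [a, c]]"
    \<comment> \<open>The sign of the outer bracket, whose first argument has degree
      \<open>p + q + s\<close>, together with the sign of the inner one. Multiplying the vanishing
      \<open>jacobiator\<close>, solved for \<open>?X\<close>, by it gives the Jacobi
      identity.\<close>
    let ?e = "\<langle>p + q + s + \<alpha>, s + \<alpha>\<rangle> + \<langle>p + \<alpha>, s + \<alpha>\<rangle>"
    have "jacobiator \<alpha> s S p a q b c [] = 0"
      using SJ_self_eq_zero_iff[OF S s] SS a b c by blast
    then have "?X = signed \<langle>p + \<alpha>, s + \<alpha>\<rangle> ?Y - signed \<langle>q + \<alpha>, s + p\<rangle> ?Z"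
      by (simp add: jacobiator_def ev_def signed_apply algebra_simps eq_neg_iff_add_eq_0)
    then have "signed ?e ?X = signed (?e + \<langle>p + \<alpha>, s + \<alpha>\<rangle>) ?Y - signed (?e + \<langle>q + \<alpha>, s + p\<rangle>) ?Z"
      by (simp only: signed_diff signed_signed)
    also have "\<dots> = signed (\<langle>p + \<alpha>, s + \<alpha>\<rangle> + \<langle>q + \<alpha>, s + \<alpha>\<rangle>) ?Y
        - signed (\<langle>p + s, q + s\<rangle> + (\<langle>q + \<alpha>, s + \<alpha>\<rangle> + \<langle>p + \<alpha>, s + \<alpha>\<rangle>)) ?Z"
      using s by (intro arg_cong2[where f = "(-)"] signed_cong) (auto simp: pairing_simps pairing_commute)
    finally show "?br (?br a b) c = ?br a (?br b c) - signed \<langle>p + s, q + s\<rangle> (?br b (?br a c))"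
      unfolding br[OF br_in[OF a b]] unfolding br[OF a] br[OF b]
        linear_signed_arg[OF lin1] linear_signed_arg[OF lin2[OF a]] linear_signed_arg[OF lin2[OF b]] signed_signed .
  qed
qed

lemma poisson_bracket_derived:
  assumes "supercanonical_DE scl A \<alpha> s S"
  shows "poisson_bracket scl A s (derived_bracket A \<alpha> s S)"
proof -
  have S: "S \<in> Dop scl A \<alpha> 2 s" and "supercanonical scl A \<alpha> s S" and "ev S 1 = 0"
    using assms by (auto simp: supercanonical_DE_def DEop_def simp del: Dop.simps)
  \<comment> \<open>The condition on S concerns the unit in the first slot, the Poisson condition
    the unit in the second. The symmetry, available for homogeneous arguments, exchanges
    them.\<close>
  have "S [hcomp A a p, 1] = 0" for a p
    using Dop_2D(4)[OF S hcomp_in_A[of a p] one_A] \<open>ev S 1 = 0\<close> by (simp add: ev_def fun_eq_iff)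
  then have "derived_bracket A \<alpha> s S a 1 = 0" for a
    by (simp add: derived_bracket_def hom_extend_def)
  with jacobi_bracket_derived[OF \<open>supercanonical scl A \<alpha> s S\<close>] show ?thesis
    by (simp add: poisson_bracket_def)
qed

section \<open>From brackets to supercanonical structures\<close>

lemma jacobi_bracketD:
  assumes "jacobi_bracket scl A k br"
  shows "Vector_Spaces.linear scl scl (\<lambda>b. br a b)"
    and "Vector_Spaces.linear scl scl (\<lambda>a. br a b)"
    and "a \<in> A p \<Longrightarrow> b \<in> A q \<Longrightarrow> br a b \<in> A (p + q + k)"
    and "a \<in> A p \<Longrightarrow> b \<in> A q \<Longrightarrow> br a b = - signed \<langle>p + k, q + k\<rangle> (br b a)"
    and "a \<in> A p \<Longrightarrow> b \<in> A q \<Longrightarrow> c \<in> A r \<Longrightarrow>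
      br a (b * c) = br a b * c + signed \<langle>p + k, q\<rangle> (b * br a c) - br a 1 * b * c"
    and "a \<in> A p \<Longrightarrow> b \<in> A q \<Longrightarrow> c \<in> A r \<Longrightarrow>
      br (br a b) c = br a (br b c) - signed \<langle>p + k, q + k\<rangle> (br b (br a c))"
proof -
  note * = assms[unfolded jacobi_bracket_def]
  show "Vector_Spaces.linear scl scl (\<lambda>b. br a b)"
    by (rule *[THEN conjunct1, THEN spec])
  show "Vector_Spaces.linear scl scl (\<lambda>a. br a b)"
    by (rule *[THEN conjunct2, THEN conjunct1, THEN spec])
  note * = *[THEN conjunct2, THEN conjunct2]
  show "a \<in> A p \<Longrightarrow> b \<in> A q \<Longrightarrow> br a b \<in> A (p + q + k)"
    using *[THEN conjunct1] by blast
  note * = *[THEN conjunct2]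
  show "a \<in> A p \<Longrightarrow> b \<in> A q \<Longrightarrow> br a b = - signed \<langle>p + k, q + k\<rangle> (br b a)"
    using *[THEN conjunct1] by blast
  note * = *[THEN conjunct2]
  show "a \<in> A p \<Longrightarrow> b \<in> A q \<Longrightarrow> c \<in> A r \<Longrightarrow>
      br a (b * c) = br a b * c + signed \<langle>p + k, q\<rangle> (b * br a c) - br a 1 * b * c"
    using *[THEN conjunct1] by blast
  show "a \<in> A p \<Longrightarrow> b \<in> A q \<Longrightarrow> c \<in> A r \<Longrightarrow>
      br (br a b) c = br a (br b c) - signed \<langle>p + k, q + k\<rangle> (br b (br a c))"
    using *[THEN conjunct2] by blast
qed

text \<open>The symmetry moves the product to the second slot, where the Leibniz rule applies, and
  then moves the factors back. Linearity removes homogeneity of \<open>c\<close>, because elements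
  of order 2 satisfy their rule as an identity of maps.\<close>

lemma jacobi_bracket_mult_left:
  assumes br: "jacobi_bracket scl A k br" and a: "a \<in> A p" and b: "b \<in> A q"
  shows "br (a * b) c = signed \<langle>p, q\<rangle> (b * br a c) + a * br b c - a * b * br 1 c"
proof (rule linear_eqI[of "\<lambda>c. br (a * b) c"])
  note D = jacobi_bracketD[OF br]
  show "Vector_Spaces.linear scl scl (\<lambda>c. br (a * b) c)"
    by (rule D)
  show "Vector_Spaces.linear scl scl (\<lambda>c. signed \<langle>p, q\<rangle> (b * br a c) + a * br b c - a * b * br 1 c)"
    by (rule linearI)
      (simp_all add: linear_mapD[OF D(1)] signed_def distrib_left scale_mult_right[symmetric] scale_minus_right
        scale_right_distrib scale_right_diff_distrib)
  fix r c
  assume c: "c \<in> A r"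
  let ?e = "\<langle>p + q + k, r + k\<rangle>"
  have "br (a * b) c = - signed ?e (br c (a * b))"
    by (rule D(4)[OF mult_A[OF a b] c])
  also have "\<dots> = - signed ?e (br c a * b + signed \<langle>r + k, p\<rangle> (a * br c b) - br c 1 * (a * b))"
    by (simp only: D(5)[OF c a b] mult.assoc)
  also have "\<dots> = signed (?e + \<langle>r + k, p + k\<rangle>) (br a c * b)
      + signed (?e + \<langle>r + k, p\<rangle> + \<langle>r + k, q + k\<rangle>) (a * br b c)
      - signed (?e + \<langle>r + k, k\<rangle>) (br 1 c * (a * b))"
    by (simp add: D(4)[OF c a] D(4)[OF c b] D(4)[OF c one_A] signed_def)
  \<comment> \<open>Graded commutativity moves \<open>b\<close> and \<open>a * b\<close> to the left
    of the brackets; its signs combine with those of the symmetry.\<close>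
  also have "\<dots> = signed \<langle>p, q\<rangle> (b * br a c) + signed 0 (a * br b c) - signed 0 (a * b * br 1 c)"
    unfolding graded_commute[OF D(3)[OF a c] b] graded_commute[OF D(3)[OF one_A c] mult_A[OF a b]] signed_signed
    by (intro arg_cong2[where f = "(+)"] arg_cong2[where f = "(-)"] signed_cong)
      (auto simp: pairing_simps pairing_commute)
  finally show "br (a * b) c = signed \<langle>p, q\<rangle> (b * br a c) + a * br b c - a * b * br 1 c"
    by simp
qed

lemma binary_op_simps [simp]:
  "binary_op br [] = 0" "binary_op br [a] = 0" "binary_op br [a, b] = br a b"
  "binary_op br (a # b # c # xs) = 0"
  by (simp_all add: binary_op_def)

lemma binary_op_in_Dop:
  assumes br: "jacobi_bracket scl A \<alpha> br"
  shows "binary_op br \<in> Dop scl A \<alpha> 2 \<alpha>"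
proof -
  note D = jacobi_bracketD[OF br]
  let ?S = "binary_op br"
  have lin: "Vector_Spaces.linear scl scl (\<lambda>x. ?S (x # xs))" for xs
  proof (cases xs)
    case (Cons y ys)
    then show ?thesis
      by (cases ys) (simp_all add: linear_zero D(2))
  qed (simp add: linear_zero)
  have lin': "Vector_Spaces.linear scl scl (\<lambda>x. ?S (a # x # xs))" for a xs
    by (cases xs) (simp_all add: linear_zero D(1))
  have binary_eq: "E = F" if "\<And>x. E [x] = F [x]" "E [] = F []" "\<And>x y ys. E (x # y # ys) = F (x # y # ys)"
    for E F :: "'a list \<Rightarrow> 'a"
  proof
    show "E xs = F xs" for xs
      using that by (cases xs; cases "tl xs") auto
  qed
  have const: "ev (ev ?S a) b = const_op (br a b)" for a b
    by (auto simp: fun_eq_iff ev_def const_op_def split: list.splits)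
  have Sa: "ev ?S a \<in> Dop scl A \<alpha> (Suc 0) (\<alpha> + p)" if a: "a \<in> A p" for a p
    using lin' D(3)[OF a] D(5)[OF a]
    by (auto simp: graded_linear_op_def linear_ev_iff const image_iff ac_simps) (auto simp: ev_def pairing_commute ac_simps)
  have "ev ?S (a * b) = rmul \<alpha> (Suc 0) (\<alpha> + p) (ev ?S a) q b
      + signed \<langle>p, \<alpha> + int (Suc 0) *s \<alpha>\<rangle> (lmul a (ev ?S b))
      - rmul \<alpha> (Suc 0) \<alpha> (ev ?S 1) (p + q) (a * b)" if a: "a \<in> A p" and b: "b \<in> A q" for a b p q
    \<comment> \<open>The module signs pair with \<alpha> + \<alpha>, hence evenly: only the parity
      of \<langle>p, q\<rangle> survives, in front of the first term.\<close>
    by (rule binary_eq)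
      (simp_all add: rmul_def lmul_def ev_def signed_apply jacobi_bracket_mult_left[OF br a b],
       auto simp: signed_def pairing_simps pairing_commute)
  moreover have "ev (ev ?S a) b = - signed \<langle>p + \<alpha>, q + \<alpha>\<rangle> (ev (ev ?S b) a)"
    if a: "a \<in> A p" and b: "b \<in> A q" for a b p q
    unfolding const using D(4)[OF a b] by (auto simp: fun_eq_iff const_op_def signed_apply split: list.splits)
  moreover have "graded_linear_op scl A (Dop scl A \<alpha> (Suc 0)) \<alpha> ?S"
    using Sa lin by (simp add: graded_linear_op_def linear_ev_iff del: Dop.simps)
  ultimately show ?thesis
    unfolding numeral_2_eq_2 Dop.simps(3) by (intro CollectI conjI allI ballI)
qed

text \<open>For \<open>s = \<alpha>\<close> the pairings with \<alpha> + \<alpha> are even, so the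
  vanishing of the \<open>jacobiator\<close> is literally the Jacobi identity of
  \<open>br\<close>.\<close>

lemma supercanonical_binary_op:
  assumes br: "jacobi_bracket scl A \<alpha> br"
  shows "supercanonical scl A \<alpha> \<alpha> (binary_op br)"
proof -
  have even: "even \<langle>\<alpha> + \<alpha>, \<alpha> + \<alpha>\<rangle>"
    unfolding pairing_add_left pairing_add_right by simp
  have "jacobiator \<alpha> \<alpha> (binary_op br) p a q b c [] = 0"
    if "a \<in> A p" "b \<in> A q" "c \<in> A r" for p q r a b c
  proof -
    have sign: "even \<langle>p + \<alpha>, \<alpha> + \<alpha>\<rangle> = even 0" "even \<langle>q + \<alpha>, \<alpha> + p\<rangle> = even \<langle>p + \<alpha>, q + \<alpha>\<rangle>"
      by (auto simp: pairing_simps pairing_commute)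
    show ?thesis
      unfolding jacobiator_def signed_cong[OF sign(1)] signed_cong[OF sign(2)]
      by (simp add: ev_def signed_apply jacobi_bracketD(6)[OF br that])
  qed
  then show ?thesis
    using SJ_self_eq_zero_iff[OF binary_op_in_Dop[OF br] even] binary_op_in_Dop[OF br] even
    by (simp add: supercanonical_def del: Dop.simps)
qed

lemma supercanonical_DE_binary_op:
  assumes "poisson_bracket scl A \<alpha> br"
  shows "supercanonical_DE scl A \<alpha> \<alpha> (binary_op br)"
proof -
  have br: "jacobi_bracket scl A \<alpha> br" and one: "br a 1 = 0" for a
    using assms by (auto simp: poisson_bracket_def)
  \<comment> \<open>The symmetry exchanges the slots for homogeneous \<open>x\<close>; linearity
    gives all \<open>x\<close>.\<close>
  have "br 1 x = 0" for x
  proof (rule linear_eqI[where f = "br 1" and g = "\<lambda>x. 0"])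
    show "Vector_Spaces.linear scl scl (br 1)"
      by (rule jacobi_bracketD(1)[OF br])
    show "Vector_Spaces.linear scl scl (\<lambda>x. 0)"
      by (rule linear_zero)
    show "br 1 a = 0" if "a \<in> A p" for a p
      using jacobi_bracketD(4)[OF br one_A that] by (simp add: one)
  qed
  then have "ev (binary_op br) 1 = 0"
    by (auto simp: fun_eq_iff ev_def binary_op_def split: list.splits)
  then show ?thesis
    using supercanonical_binary_op[OF br] binary_op_in_Dop[OF br]
    by (simp add: supercanonical_DE_def DEop_def del: Dop.simps)
qed

end

theorem theorem11:
  fixes scl :: "'k::field_char_0 \<Rightarrow> 'a::{ring, monoid_mult} \<Rightarrow> 'a"
    and A :: "int ^ 'n \<Rightarrow> 'a set"
    and \<alpha> :: "int ^ 'n"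
  assumes "graded_comm_algebra scl A"
  shows
    "(\<forall>s S. supercanonical scl A \<alpha> s S \<longrightarrow>
        jacobi_bracket scl A s (derived_bracket A \<alpha> s S)) \<and>
     (\<forall>s S. supercanonical_DE scl A \<alpha> s S \<longrightarrow>
        poisson_bracket scl A s (derived_bracket A \<alpha> s S)) \<and>
     (\<forall>br. jacobi_bracket scl A \<alpha> br \<longrightarrow>
        supercanonical scl A \<alpha> \<alpha> (binary_op br)) \<and>
     (\<forall>br. poisson_bracket scl A \<alpha> br \<longrightarrow>
        supercanonical_DE scl A \<alpha> \<alpha> (binary_op br))"
proof -
  interpret graded_comm_algebra scl A
    by (rule assms)
  show ?thesis
    by (intro conjI allI impI jacobi_bracket_derived poisson_bracket_derived
      supercanonical_binary_op supercanonical_DE_binary_op)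
qed

end
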